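(* Let $\alpha\in(0,1)\setminus\mathbb{Q}$ and let $(x_1,x_2,\dots)\in\mathcal{V}'_\alpha$. Then (1) if $x_n=0$ for some $n$, then necessarily $x_{n-1}=\dots=x_1=0$ as well; (2) it is impossible that $x_n=a_n$ for some $n$.
   Context: Let $\alpha\in(0,1)\setminus\mathbb{Q}$ have the regular continued fraction expansion $\alpha=\cfrac{1}{a_1+\cfrac{1}{a_2+\cdots}}$ with partial quotients $a_n\in\mathbb{N}$, $n\ge1$. Define $p_1=0$, $p_2=1$, $q_1=1$, $q_2=a_1$, and $p_{n+1}=a_np_n+p_{n-1}$, $q_{n+1}=a_nq_n+q_{n-1}$ for $n\ge2$. Put $\alpha_n=|q_n\alpha-p_n|$ for $n\ge1$. Let $Z_\alpha=\prod_{n=1}^\infty\{0,1,\dots,a_n\}$, and let $\mathcal{X}'_\alpha\subset Z_\alpha$ be the set of all sequences $(x_1,x_2,\dots)\in Z_\alpha$ such that, for every $n\ge1$, $x_n=a_n$ implies $x_{n+1}=0$. Define $\psi'_\alpha$ on $\mathcal{X}'_\alpha$ by $\psi'_\alpha(x_1,x_2,\dots)=\sum_{n=1}^\infty x_n\alpha_n$. Let $\mathcal{V}_\alpha$ be the set of all $x\in(0,1)$ for which there exists exactly one sequence $(x_1,x_2,\dots)\in Z_\alpha$ with $x=\sum_{n=1}^\infty x_n\alpha_n$, and let $\mathcal{V}'_\alpha=(\psi'_\alpha)^{-1}(\mathcal{V}_\alpha)\subset\mathcal{X}'_\alpha$. *)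

theory Defs
  imports Complex_Main "HOL-Library.FuncSet"
begin

text \<open>
  Partial quotients and digits are indexed from 1, so a sequence is a function on the naturals
  whose value at 0 plays no role.
\<close>

primrec cf_value :: "nat list \<Rightarrow> real" where
  "cf_value [] = 0"
| "cf_value (b # bs) = 1 / (real b + cf_value bs)"

definition regular_cf :: "(nat \<Rightarrow> nat) \<Rightarrow> real \<Rightarrow> bool" where
  "regular_cf a \<alpha> \<longleftrightarrow>
     (\<forall>n\<ge>1. a n \<ge> 1) \<and> (\<lambda>n. cf_value (map a [1..<Suc n])) \<longlonglongrightarrow> \<alpha>"

text \<open>
  The values at 0 are the ones which extend the recursion
  \<open>p\<^sub>n\<^sub>+\<^sub>1 = a\<^sub>n p\<^sub>n + p\<^sub>n\<^sub>-\<^sub>1\<close>, \<open>q\<^sub>n\<^sub>+\<^sub>1 = a\<^sub>n q\<^sub>n + q\<^sub>n\<^sub>-\<^sub>1\<close> to \<open>n = 1\<close>;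
  the initial values \<open>p\<^sub>2 = 1\<close> and \<open>q\<^sub>2 = a\<^sub>1\<close> are then instances of it.
\<close>

fun cf_p :: "(nat \<Rightarrow> nat) \<Rightarrow> nat \<Rightarrow> nat" where
  "cf_p a 0 = 1"
| "cf_p a (Suc 0) = 0"
| "cf_p a (Suc (Suc n)) = a (Suc n) * cf_p a (Suc n) + cf_p a n"

fun cf_q :: "(nat \<Rightarrow> nat) \<Rightarrow> nat \<Rightarrow> nat" where
  "cf_q a 0 = 0"
| "cf_q a (Suc 0) = 1"
| "cf_q a (Suc (Suc n)) = a (Suc n) * cf_q a (Suc n) + cf_q a n"

lemma cf_p_2: "cf_p a 2 = 1" and cf_q_2: "cf_q a 2 = a 1"
  by (simp_all add: numeral_2_eq_2)

lemma cf_p_rec: "n \<ge> 2 \<Longrightarrow> cf_p a (n + 1) = a n * cf_p a n + cf_p a (n - 1)"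
  and cf_q_rec: "n \<ge> 2 \<Longrightarrow> cf_q a (n + 1) = a n * cf_q a n + cf_q a (n - 1)"
  by (cases n; simp)+

definition cf_dist :: "(nat \<Rightarrow> nat) \<Rightarrow> real \<Rightarrow> nat \<Rightarrow> real" where
  "cf_dist a \<alpha> n = \<bar>real (cf_q a n) * \<alpha> - real (cf_p a n)\<bar>"

text \<open>
  The extensional product pins the value of a digit sequence at 0 to \<^const>\<open>undefined\<close>, so that
  uniqueness of an expansion below is uniqueness of the digits with index at least 1.
\<close>

definition Z_seqs :: "(nat \<Rightarrow> nat) \<Rightarrow> (nat \<Rightarrow> nat) set" where
  "Z_seqs a = (\<Pi>\<^sub>E n\<in>{1..}. {0..a n})"

definition X'_seqs :: "(nat \<Rightarrow> nat) \<Rightarrow> (nat \<Rightarrow> nat) set" where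
  "X'_seqs a = {x \<in> Z_seqs a. \<forall>n\<ge>1. x n = a n \<longrightarrow> x (n + 1) = 0}"

text \<open>The summation index is shifted: the sum runs over \<open>x\<^sub>n \<alpha>\<^sub>n\<close> for \<open>n \<ge> 1\<close>.\<close>

definition digit_sum :: "(nat \<Rightarrow> nat) \<Rightarrow> real \<Rightarrow> (nat \<Rightarrow> nat) \<Rightarrow> real" where
  "digit_sum a \<alpha> x = (\<Sum>n. real (x (Suc n)) * cf_dist a \<alpha> (Suc n))"

definition V_set :: "(nat \<Rightarrow> nat) \<Rightarrow> real \<Rightarrow> real set" where
  "V_set a \<alpha> = {v \<in> {0<..<1}. \<exists>!x. x \<in> Z_seqs a \<and> v = digit_sum a \<alpha> x}"

definition V'_set :: "(nat \<Rightarrow> nat) \<Rightarrow> real \<Rightarrow> (nat \<Rightarrow> nat) set" where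
  "V'_set a \<alpha> = {x \<in> X'_seqs a. digit_sum a \<alpha> x \<in> V_set a \<alpha>}"

end

theory Submission imports Defs begin

text \<open>
  Write \<open>\<alpha>\<^sub>n\<close> for the weights \<^term>\<open>cf_dist a \<alpha> n\<close>.  They are nonnegative, tend to 0 and satisfy
  \<open>\<alpha>\<^sub>n = a\<^sub>n\<^sub>+\<^sub>1 \<alpha>\<^sub>n\<^sub>+\<^sub>1 + \<alpha>\<^sub>n\<^sub>+\<^sub>2\<close>.  This recurrence is a carry rule: digits \<open>(c, 0, e)\<close> in
  the places \<open>n, n + 1, n + 2\<close> may be replaced by \<open>(c - 1, a\<^sub>n\<^sub>+\<^sub>1, e + 1)\<close> without changing the sum, and the
  result is again admissible if \<open>c \<ge> 1\<close> and \<open>e\<close> is not maximal (\<open>cf_carry\<close>).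

  Suppose that the sum of \<open>x \<in> X'\<close> has no other expansion and that a zero digit follows a nonzero
  digit.  The carry rule forces the next digit to be maximal, hence nonzero, and membership in
  \<open>X'\<close> forces the digit after it to be 0.  So the same situation recurs two places further on, and
  from that point \<open>x\<close> alternates between 0 and the maximal digit.  But then the carry can be
  performed infinitely often: iterating the recurrence gives
  \<open>\<alpha>\<^sub>n = a\<^sub>n\<^sub>+\<^sub>1 \<alpha>\<^sub>n\<^sub>+\<^sub>1 + a\<^sub>n\<^sub>+\<^sub>3 \<alpha>\<^sub>n\<^sub>+\<^sub>3 + \<dots>\<close>, so one unit of the nonzero digit can be traded for
  maximal digits in all the places that held a zero (\<open>cf_infinite_carry\<close>).  Either way there is a
  second expansion, so a zero digit is preceded by zeros only.  A maximal digit is nonzero and is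
  followed by 0 in \<open>X'\<close>, so it is excluded as well.
\<close>

section \<open>The weights of an irrational number\<close>

lemma cf_value_nonneg: "cf_value bs \<ge> 0"
  by (induction bs) auto

locale irrational_cf =
  fixes a :: "nat \<Rightarrow> nat" and \<alpha> :: real
  assumes irrational: "\<alpha> \<notin> \<rat>" and cf: "regular_cf a \<alpha>"
begin

lemma quotient_ge_1: "n \<ge> 1 \<Longrightarrow> a n \<ge> 1"
  using cf by (simp add: regular_cf_def)

text \<open>
  This is the orbit of \<open>\<alpha>\<close> under the Gauss map; the subtracted integer is the given partial
  quotient instead of a floor, so that no floor has to be computed.
\<close>

primrec tail :: "nat \<Rightarrow> real" where
  "tail 0 = \<alpha>"
| "tail (Suc n) = 1 / tail n - real (a (Suc n))"

lemma tail_irrational: "tail n \<notin> \<rat>"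
proof (induction n)
  case 0
  show ?case by (simp add: irrational)
next
  case (Suc n)
  have "1 / (tail (Suc n) + real (a (Suc n))) = tail n"
    by simp
  then show ?case
    using Suc by (metis Rats_1 Rats_add Rats_divide Rats_of_nat)
qed

lemma tail_limit: "(\<lambda>k. cf_value (map a [Suc n..<Suc (n + k)])) \<longlonglongrightarrow> tail n"
proof (induction n)
  case 0
  then show ?case using cf by (simp add: regular_cf_def)
next
  case (Suc n)
  let ?v = "\<lambda>n k. cf_value (map a [Suc n..<Suc (n + k)])"
  have "tail n \<noteq> 0"
    using tail_irrational[of n] Rats_0 by metis
  then have "(\<lambda>k. 1 / ?v n (Suc k) - real (a (Suc n))) \<longlonglongrightarrow> tail (Suc n)"
    unfolding tail.simps using Suc by (intro tendsto_intros LIMSEQ_Suc)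
  moreover have "1 / ?v n (Suc k) - real (a (Suc n)) = ?v (Suc n) k" for k
    by (simp add: upt_conv_Cons del: upt_Suc)
  ultimately show ?case by simp
qed

lemma tail_pos: "tail n > 0"
proof -
  have "0 \<le> tail n"
    by (intro LIMSEQ_le_const[OF tail_limit]) (auto intro: cf_value_nonneg)
  moreover have "tail n \<noteq> 0"
    using tail_irrational[of n] Rats_0 by metis
  ultimately show ?thesis by simp
qed

text \<open>
  This is where the sign of \<open>q\<^sub>n \<alpha> - p\<^sub>n\<close> is controlled: the points of the Gauss orbit are positive, so
  consecutive differences have opposite signs and the recurrence for \<open>p\<close> and \<open>q\<close> turns into one
  for the absolute values.
\<close>

lemma cf_difference_ratio:
  "real (cf_q a (Suc n)) * \<alpha> - real (cf_p a (Suc n))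
     = - tail n * (real (cf_q a n) * \<alpha> - real (cf_p a n))"
proof (induction n)
  case 0
  then show ?case by simp
next
  case (Suc n)
  let ?D = "\<lambda>n. real (cf_q a n) * \<alpha> - real (cf_p a n)"
  have "?D (Suc (Suc n)) = real (a (Suc n)) * ?D (Suc n) + ?D n"
    by (simp add: algebra_simps)
  also have "?D n = - (1 / tail n) * ?D (Suc n)"
    using Suc tail_pos[of n] by simp
  also have "real (a (Suc n)) * ?D (Suc n) + - (1 / tail n) * ?D (Suc n)
               = - tail (Suc n) * ?D (Suc n)"
    by (simp add: left_diff_distrib)
  finally show ?case .
qed

lemma cf_dist_ratio: "cf_dist a \<alpha> (Suc n) = tail n * cf_dist a \<alpha> n"
  unfolding cf_dist_def cf_difference_ratio using tail_pos[of n] by (simp add: abs_mult)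

lemma cf_dist_rec:
  "cf_dist a \<alpha> n = real (a (Suc n)) * cf_dist a \<alpha> (Suc n) + cf_dist a \<alpha> (Suc (Suc n))"
proof -
  have "cf_dist a \<alpha> n = (1 / tail n) * cf_dist a \<alpha> (Suc n)"
    using cf_dist_ratio[of n] tail_pos[of n] by simp
  then show ?thesis
    by (simp only: cf_dist_ratio[of "Suc n"] tail.simps algebra_simps)
qed

lemma cf_dist_nonneg: "cf_dist a \<alpha> n \<ge> 0"
  by (simp add: cf_dist_def)

text \<open>By the recurrence the terms are \<open>\<alpha>\<^sub>n - \<alpha>\<^sub>n\<^sub>+\<^sub>2\<close>, so the partial sums telescope.\<close>

lemma summable_max_digits: "summable (\<lambda>n. real (a (Suc n)) * cf_dist a \<alpha> (Suc n))"
proof (rule summableI_nonneg_bounded)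
  fix N
  have "(\<Sum>n<N. real (a (Suc n)) * cf_dist a \<alpha> (Suc n))
          = cf_dist a \<alpha> 0 + cf_dist a \<alpha> 1 - cf_dist a \<alpha> N - cf_dist a \<alpha> (Suc N)"
  proof (induction N)
    case 0
    then show ?case by simp
  next
    case (Suc N)
    then show ?case using cf_dist_rec[of N] by simp
  qed
  also have "\<dots> \<le> cf_dist a \<alpha> 0 + cf_dist a \<alpha> 1"
    using cf_dist_nonneg[of N] cf_dist_nonneg[of "Suc N"] by simp
  finally show "(\<Sum>n<N. real (a (Suc n)) * cf_dist a \<alpha> (Suc n)) \<le> \<dots>" .
qed (simp add: cf_dist_nonneg)

lemma cf_dist_tendsto_0: "cf_dist a \<alpha> \<longlonglongrightarrow> 0"
proof -
  have "(\<lambda>n. real (a (Suc n)) * cf_dist a \<alpha> (Suc n)) \<longlonglongrightarrow> 0"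
    by (rule summable_LIMSEQ_zero[OF summable_max_digits])
  then have "(\<lambda>n. cf_dist a \<alpha> (Suc n)) \<longlonglongrightarrow> 0"
  proof (rule tendsto_0_le[where K = 1], intro always_eventually allI)
    fix n
    have "1 * cf_dist a \<alpha> (Suc n) \<le> real (a (Suc n)) * cf_dist a \<alpha> (Suc n)"
      using quotient_ge_1[of "Suc n"] by (intro mult_right_mono cf_dist_nonneg) simp
    then show "norm (cf_dist a \<alpha> (Suc n))
                 \<le> norm (real (a (Suc n)) * cf_dist a \<alpha> (Suc n)) * 1"
      using cf_dist_nonneg by simp
  qed
  then show ?thesis by (rule LIMSEQ_imp_Suc)
qed

section \<open>Carries\<close>

lemma summable_digits:
  assumes "x \<in> Z_seqs a"
  shows "summable (\<lambda>n. real (x (Suc n)) * cf_dist a \<alpha> (Suc n))"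
proof (rule summable_comparison_test'[OF summable_max_digits])
  fix n
  have "x (Suc n) \<le> a (Suc n)"
    using assms by (auto simp: Z_seqs_def PiE_iff)
  then show "norm (real (x (Suc n)) * cf_dist a \<alpha> (Suc n))
               \<le> real (a (Suc n)) * cf_dist a \<alpha> (Suc n)"
    by (simp add: cf_dist_nonneg mult_right_mono)
qed

text \<open>
  Only a subsequence of the partial sums has to be controlled: an infinite carry changes them in
  steps of two places, and a single carry leaves them unchanged once it is completed.
\<close>

lemma digit_sum_eqI:
  assumes "x \<in> Z_seqs a" "y \<in> Z_seqs a" and s: "strict_mono s"
    and lim: "(\<lambda>k. \<Sum>n<s k. (real (x (Suc n)) - real (y (Suc n))) * cf_dist a \<alpha> (Suc n))
                \<longlonglongrightarrow> 0"
  shows "digit_sum a \<alpha> x = digit_sum a \<alpha> y"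
proof -
  have "(\<lambda>n. real (x (Suc n)) * cf_dist a \<alpha> (Suc n) - real (y (Suc n)) * cf_dist a \<alpha> (Suc n))
          sums (digit_sum a \<alpha> x - digit_sum a \<alpha> y)"
    unfolding digit_sum_def by (intro sums_diff summable_sums summable_digits assms)
  then have "(\<lambda>N. \<Sum>n<N. (real (x (Suc n)) - real (y (Suc n))) * cf_dist a \<alpha> (Suc n))
          \<longlonglongrightarrow> digit_sum a \<alpha> x - digit_sum a \<alpha> y"
    by (simp add: sums_def left_diff_distrib)
  from LIMSEQ_subseq_LIMSEQ[OF this s] lim
  have "digit_sum a \<alpha> x - digit_sum a \<alpha> y = 0"
    by (auto simp: o_def dest: LIMSEQ_unique)
  then show ?thesis by simp
qed

lemma cf_carry:
  assumes Z: "x \<in> Z_seqs a" and m: "m \<ge> 1"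
    and digits: "x m \<ge> 1" "x (m + 1) = 0" "x (m + 2) < a (m + 2)"
  obtains y where "y \<in> Z_seqs a" "y \<noteq> x" "digit_sum a \<alpha> y = digit_sum a \<alpha> x"
proof
  let ?y = "x(m := x m - 1, m + 1 := a (m + 1), m + 2 := x (m + 2) + 1)"
  obtain i where i: "m = Suc i" using m by (cases m) auto
  have xm: "x m - 1 \<le> a m"
    using Z m by (auto simp: Z_seqs_def PiE_iff intro: le_trans[OF diff_le_self])
  show y: "?y \<in> Z_seqs a"
    using Z digits m xm by (auto simp: Z_seqs_def PiE_iff extensional_def)
  show "?y \<noteq> x"
    using digits(1) by (auto dest: fun_cong[of _ _ m])
  let ?f = "\<lambda>n. (real (x (Suc n)) - real (?y (Suc n))) * cf_dist a \<alpha> (Suc n)"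
  have "(\<Sum>n<k + (i + 3). ?f n) = 0" for k
  proof -
    have "(\<Sum>n<k + (i + 3). ?f n) = (\<Sum>n\<in>{i, Suc i, Suc (Suc i)}. ?f n)"
      by (rule sum.mono_neutral_right) (auto simp: i)
    also have "\<dots> = 0"
      using cf_dist_rec[of "Suc i"] digits by (simp add: i)
    finally show ?thesis .
  qed
  then show "digit_sum a \<alpha> ?y = digit_sum a \<alpha> x"
    by (intro digit_sum_eqI[symmetric, OF Z y, of "\<lambda>k. k + (i + 3)"])
       (auto simp: strict_mono_def)
qed

lemma cf_infinite_carry:
  assumes Z: "x \<in> Z_seqs a" and m: "m \<ge> 1" and xm: "x m \<ge> 1"
    and zero: "\<And>k. x (m + 2 * k + 1) = 0" and full: "\<And>k. x (m + 2 * k + 2) = a (m + 2 * k + 2)"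
  obtains y where "y \<in> Z_seqs a" "y \<noteq> x" "digit_sum a \<alpha> y = digit_sum a \<alpha> x"
proof
  let ?y = "\<lambda>n. if n < m then x n else if n = m then x m - 1 else a n"
  obtain i where i: "m = Suc i" using m by (cases m) auto
  have "x m - 1 \<le> a m"
    using Z m by (auto simp: Z_seqs_def PiE_iff intro: le_trans[OF diff_le_self])
  then show y: "?y \<in> Z_seqs a"
    using Z m by (auto simp: Z_seqs_def PiE_iff extensional_def)
  show "?y \<noteq> x"
    using xm by (auto dest: fun_cong[of _ _ m])
  let ?f = "\<lambda>n. (real (x (Suc n)) - real (?y (Suc n))) * cf_dist a \<alpha> (Suc n)"
  have partial: "(\<Sum>n<Suc (i + 2 * k). ?f n) = cf_dist a \<alpha> (Suc (i + 2 * k))" for k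
  proof (induction k)
    case 0
    have "(\<Sum>n<i. ?f n) = 0" by (rule sum.neutral) (simp add: i)
    then show ?case using xm by (simp add: i)
  next
    case (Suc k)
    have "?f (Suc (i + 2 * k))
            = - (real (a (Suc (Suc (i + 2 * k)))) * cf_dist a \<alpha> (Suc (Suc (i + 2 * k))))"
      using zero[of k] by (simp add: i)
    moreover have "?f (Suc (Suc (i + 2 * k))) = 0"
      using full[of k] by (simp add: i)
    ultimately show ?case
      using Suc.IH cf_dist_rec[of "Suc (i + 2 * k)"] by simp
  qed
  have s: "strict_mono (\<lambda>k. Suc (i + 2 * k))"
    by (simp add: strict_mono_def)
  have "(\<lambda>k. \<Sum>n<Suc (i + 2 * k). ?f n) \<longlonglongrightarrow> 0"
    unfolding partial using LIMSEQ_subseq_LIMSEQ[OF cf_dist_tendsto_0 s] by (simp add: o_def)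
  then show "digit_sum a \<alpha> ?y = digit_sum a \<alpha> x"
    by (rule digit_sum_eqI[symmetric, OF Z y s])
qed

section \<open>Unique expansions\<close>

lemma V'_set_unique:
  assumes "x \<in> V'_set a \<alpha>" "y \<in> Z_seqs a" "digit_sum a \<alpha> y = digit_sum a \<alpha> x"
  shows "y = x"
proof -
  have "\<exists>!z. z \<in> Z_seqs a \<and> digit_sum a \<alpha> x = digit_sum a \<alpha> z"
    using assms(1) by (simp add: V'_set_def V_set_def)
  moreover have "x \<in> Z_seqs a"
    using assms(1) by (simp add: V'_set_def X'_seqs_def)
  ultimately show ?thesis
    using assms(2,3) by auto
qed

text \<open>
  A zero after a nonzero digit starts a pattern that either stops, which leaves room for a single
  carry, or alternates forever, which leaves room for an infinite one.
\<close>

lemma V'_set_zero_step: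
  assumes x: "x \<in> V'_set a \<alpha>" and m: "m \<ge> 1" and zero: "x (m + 1) = 0"
  shows "x m = 0"
proof (rule ccontr)
  assume "x m \<noteq> 0"
  have Z: "x \<in> Z_seqs a" and X': "\<And>n. n \<ge> 1 \<Longrightarrow> x n = a n \<Longrightarrow> x (n + 1) = 0"
    using x by (auto simp: V'_set_def X'_seqs_def)
  have full: "x (j + 2) = a (j + 2)" if "j \<ge> 1" "x j \<ge> 1" "x (j + 1) = 0" for j
  proof (rule ccontr)
    assume "x (j + 2) \<noteq> a (j + 2)"
    moreover have "x (j + 2) \<le> a (j + 2)"
      using Z by (auto simp: Z_seqs_def PiE_iff)
    ultimately have "x (j + 2) < a (j + 2)" by simp
    from cf_carry[OF Z that this] show False
      using V'_set_unique[OF x] by metis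
  qed
  have pattern: "x (m + 2 * k) \<ge> 1 \<and> x (m + 2 * k + 1) = 0" for k
  proof (induction k)
    case 0
    then show ?case using \<open>x m \<noteq> 0\<close> zero by simp
  next
    case (Suc k)
    then have "x (m + 2 * k + 2) = a (m + 2 * k + 2)"
      using m by (intro full) auto
    then show ?case
      using quotient_ge_1[of "m + 2 * k + 2"] X'[of "m + 2 * k + 2"] by simp
  qed
  have "x (m + 2 * k + 2) = a (m + 2 * k + 2)" for k
    using pattern[of k] m by (intro full) auto
  moreover have "x m \<ge> 1"
    using \<open>x m \<noteq> 0\<close> by simp
  ultimately obtain y where "y \<in> Z_seqs a" "y \<noteq> x" "digit_sum a \<alpha> y = digit_sum a \<alpha> x"
    using cf_infinite_carry[OF Z m] pattern by blast
  then show False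
    using V'_set_unique[OF x] by metis
qed

end

theorem lemma3p11:
  fixes \<alpha> :: real and a x :: "nat \<Rightarrow> nat"
  assumes "\<alpha> \<in> {0<..<1} - \<rat>"
    and "regular_cf a \<alpha>"
    and "x \<in> V'_set a \<alpha>"
  shows "(\<forall>n\<ge>1. x n = 0 \<longrightarrow> (\<forall>m. 1 \<le> m \<and> m < n \<longrightarrow> x m = 0)) \<and>
         \<not> (\<exists>n\<ge>1. x n = a n)"
proof -
  interpret irrational_cf a \<alpha>
    using assms by unfold_locales auto
  note step = V'_set_zero_step[OF assms(3)]
  have "x m = 0" if "x n = 0" "1 \<le> m" "m < n" for m n
  proof -
    have "m \<le> n" using that by simp
    then show ?thesis
      using that(1,2) by (induction m rule: inc_induct) (auto intro: step)
  qed
  moreover have "x n \<noteq> a n" if "n \<ge> 1" for n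
  proof
    assume "x n = a n"
    then have "x (n + 1) = 0"
      using assms(3) that by (auto simp: V'_set_def X'_seqs_def)
    then have "x n = 0" by (rule step[OF that])
    then show False
      using \<open>x n = a n\<close> quotient_ge_1[OF that] by simp
  qed
  ultimately show ?thesis by blast
qed

end
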